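(* Let $\sigma>0$, $h>0$, and consider the Lindley process with Laplace increments with location parameter $\mu=0$ and scale $\sigma$. Then for $n>0$ and $0\le x<h$ $$P(n|x)=\frac1{2^n\sigma^{n-1}}\Big[\sum_{j=0}^{n-1}\alpha_n^{(1,j)}x^je^{x/\sigma}+\sum_{j=0}^{n-2}\beta_n^{(1,j)}x^je^{-x/\sigma}\Big],$$ where the coefficients are determined by the initial conditions $\alpha_1^{(1,0)}=e^{-h/\sigma}$, $\beta_1^{(1,0)}=0$ and, for $n\ge1$, the recursion $$\alpha_{n+1}^{(1,j)}=-\sum_{k=j-1}^{n-1}\alpha_n^{(1,k)}\Big(-\frac\sigma2\Big)^{k-j+1}\frac{k!}{j!},\qquad j=1,\dots,n,$$ $$\beta_{n+1}^{(1,j)}=\sum_{k=j-1}^{n-2}\beta_n^{(1,k)}\Big(\frac\sigma2\Big)^{k-j+1}\frac{k!}{j!},\qquad j=1,\dots,n-1,$$ $$\alpha_{n+1}^{(1,0)}=\sum_{k=0}^{n-1}\alpha_n^{(1,k)}\Big(\frac{h^{k+1}}{k+1}+\frac{\sigma^{k+1}}{2^{k+1}}(-1)^kk!\Big)-\sum_{k=0}^{n-2}\beta_n^{(1,k)}\frac{\sigma^{k+1}}{2^{k+1}}\Gamma\Big(1+k,\frac{2h}\sigma\Big),$$ $$\beta_{n+1}^{(1,0)}=-\sum_{k=0}^{n-1}\alpha_n^{(1,k)}\frac{\sigma^{k+1}}{2^{k+1}}(-1)^kk!+\sum_{k=0}^{n-2}\beta_n^{(1,k)}\frac{\sigma^{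k+1}}{2^{k+1}}k!+\sigma\big(\alpha_n^{(1,0)}+\beta_n^{(1,0)}\big).$$
   Context: Lindley process with Laplace increments: $Z_1,Z_2,\dots$ are i.i.d. real random variables with density $f_Z(z)=\frac{1}{2\sigma}e^{-|z-\mu|/\sigma}$ (here with $\mu=0$), and $W_0=x\ge0$, $W_n=\max(0,W_{n-1}+Z_n)$ for $n\ge1$. For fixed $h>0$ and $x\in[0,h)$, the first exit time (FET) from $[0,h]$ through $h$ is $N_x=\min\{n>0: W_n\ge h\}$ given $W_0=x$, and $P(n|x)=\mathbb P[N_x=n]$ for integers $n>0$. $\Gamma(m,y)=\int_y^\infty t^{m-1}e^{-t}\,dt$. Empty sums (upper index smaller than lower index) are $0$, and $0^0=1$. *)

theory Defs
  imports "HOL-Probability.Probability"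
begin

definition laplace_density :: "real \<Rightarrow> real \<Rightarrow> real \<Rightarrow> real" where
  "laplace_density \<mu> \<sigma> z = 1 / (2 * \<sigma>) * exp (- \<bar>z - \<mu>\<bar> / \<sigma>)"

text \<open>The increments are indexed from 1; the value \<open>z 0\<close> is never used.\<close>

primrec lindley :: "real \<Rightarrow> (nat \<Rightarrow> real) \<Rightarrow> nat \<Rightarrow> real" where
  "lindley x z 0 = x"
| "lindley x z (Suc n) = max 0 (lindley x z n + z (Suc n))"

text \<open>The first exit time takes values in \<^typ>\<open>enat\<close>: a path that never reaches \<open>h\<close> has
  exit time \<open>\<infinity>\<close>, the infimum of the empty set.\<close>

definition exit_time :: "real \<Rightarrow> real \<Rightarrow> (nat \<Rightarrow> real) \<Rightarrow> enat" where
  "exit_time h x z = Inf (enat ` {n. 0 < n \<and> h \<le> lindley x z n})"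

definition exit_prob :: "'a measure \<Rightarrow> (nat \<Rightarrow> 'a \<Rightarrow> real) \<Rightarrow> real \<Rightarrow> nat \<Rightarrow> real \<Rightarrow> real" where
  "exit_prob M Z h n x = measure M {\<omega> \<in> space M. exit_time h x (\<lambda>i. Z i \<omega>) = enat n}"

definition upper_Gamma :: "real \<Rightarrow> real \<Rightarrow> real" where
  "upper_Gamma m y = (LBINT t:{y..}. t powr (m - 1) * exp (- t))"

text \<open>The coefficients \<open>\<alpha>\<^sub>n\<^sup>(\<^sup>1\<^sup>,\<^sup>j\<^sup>)\<close> and \<open>\<beta>\<^sub>n\<^sup>(\<^sup>1\<^sup>,\<^sup>j\<^sup>)\<close>, for \<open>n \<ge> 1\<close>. A sum over
  \<open>k = a, \<dots>, n - 1\<close> is written over \<open>{a..<n}\<close>, and one over \<open>k = a, \<dots>, n - 2\<close> over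
  \<open>{a..<n - 1}\<close>; for \<open>n = 1\<close> the latter is empty, as it should be. Coefficients with
  \<open>n = 0\<close> or with \<open>j\<close> outside the index range are set to 0 and never used. The only
  coefficient used without occurring in the closed form is \<open>\<beta>\<close> with \<open>n = 1\<close>, \<open>j = 0\<close>: its
  value 0 is an initial condition.\<close>

fun alpha :: "real \<Rightarrow> real \<Rightarrow> nat \<Rightarrow> nat \<Rightarrow> real"
  and beta :: "real \<Rightarrow> real \<Rightarrow> nat \<Rightarrow> nat \<Rightarrow> real"
where
  "alpha \<sigma> h 0 j = 0"
| "alpha \<sigma> h (Suc n) j =
    (if n = 0 then (if j = 0 then exp (- h / \<sigma>) else 0)
     else if j = 0 then
       (\<Sum>k\<in>{0..<n}. alpha \<sigma> h n k *
          (h ^ (k + 1) / real (k + 1) + \<sigma> ^ (k + 1) / 2 ^ (k + 1) * (- 1) ^ k * fact k))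
       - (\<Sum>k\<in>{0..<n - 1}. beta \<sigma> h n k * (\<sigma> ^ (k + 1) / 2 ^ (k + 1)) *
          upper_Gamma (1 + real k) (2 * h / \<sigma>))
     else if j \<le> n then
       - (\<Sum>k\<in>{j - 1..<n}. alpha \<sigma> h n k * (- (\<sigma> / 2)) ^ (k + 1 - j) * (fact k / fact j))
     else 0)"
| "beta \<sigma> h 0 j = 0"
| "beta \<sigma> h (Suc n) j =
    (if n = 0 then 0
     else if j = 0 then
       - (\<Sum>k\<in>{0..<n}. alpha \<sigma> h n k * (\<sigma> ^ (k + 1) / 2 ^ (k + 1)) * (- 1) ^ k * fact k)
       + (\<Sum>k\<in>{0..<n - 1}. beta \<sigma> h n k * (\<sigma> ^ (k + 1) / 2 ^ (k + 1)) * fact k)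
       + \<sigma> * (alpha \<sigma> h n 0 + beta \<sigma> h n 0)
     else if j \<le> n - 1 then
       (\<Sum>k\<in>{j - 1..<n - 1}. beta \<sigma> h n k * (\<sigma> / 2) ^ (k + 1 - j) * (fact k / fact j))
     else 0)"

end

theory Submission imports Defs begin

text \<open>
  Conditioning on the first increment gives a renewal equation. If \<open>P(n | x)\<close> is the probability
  of exiting at time \<open>n\<close> from the starting point \<open>x\<close>, then the walk survives its first step exactly
  when \<open>x + Z\<^sub>1 < h\<close>, and it restarts from \<open>max 0 (x + Z\<^sub>1)\<close>, driven by the shifted increments, which
  satisfy the same hypotheses and are independent of \<open>Z\<^sub>1\<close>. Splitting at the reflection
  threshold 0, for Laplace increments this reads

    \<open>P(n + 1 | x) = 1/(2\<sigma>) \<integral>\<^sub>0\<^sup>h exp (- \<bar>w - x\<bar> / \<sigma>) P(n | w) dw + 1/2 exp (- x / \<sigma>) P(n | 0)\<close>,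

  where the last term is the mass that the reflection places at 0. The
  equation before the split is \<open>exit_prob_first_step\<close>; the start of the recursion is
  \<open>P(1 | x) = 1/2 exp (- (h - x) / \<sigma>)\<close>, the upper tail of the increment.

  The integral operator preserves the functions \<open>p(x) exp (x / \<sigma>) + q(x) exp (- x / \<sigma>)\<close> with polynomials
  \<open>p\<close> and \<open>q\<close>. On each side of \<open>w = x\<close> the kernel is a single exponential in \<open>w\<close>; against one of the
  two summands it cancels the exponential, and an integrated power raises the degree by one, and
  against the other it leaves \<open>w\<^sup>k exp (\<plusminus> 2 w / \<sigma>)\<close>, whose antiderivative is again a polynomial times the
  same exponential. Sorting the resulting terms by powers of \<open>x\<close> gives precisely the recursion for
  the coefficients; the incomplete Gamma function is the boundary term at \<open>w = h\<close>. This computation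
  is \<open>has_integral_kernel_closed_form\<close>.
\<close>

section \<open>Antiderivatives of a power times an exponential\<close>

text \<open>Repeated integration by parts produces these polynomials:
  \<open>- exp (w / d) tail_poly d k w\<close> is the antiderivative of \<open>w\<^sup>k exp (w / d)\<close> that is a polynomial times
  \<open>exp (w / d)\<close>. The sign is chosen so that for \<open>d < 0\<close> the
  value \<open>exp (w / d) tail_poly d k w\<close> is the integral over \<open>[w, \<infinity>)\<close>.\<close>

definition tail_poly :: "real \<Rightarrow> nat \<Rightarrow> real \<Rightarrow> real" where
  "tail_poly d k w = (\<Sum>j\<le>k. fact k / fact j * (- d) ^ (k + 1 - j) * w ^ j)"

text \<open>One integration by parts; this recurrence is what the inductions below use.\<close>

lemma tail_poly_Suc:
  "tail_poly d (Suc k) w = - d * (real (Suc k) * tail_poly d k w + w ^ Suc k)"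
proof -
  have "(\<Sum>j\<le>k. fact (Suc k) / fact j * (- d) ^ (Suc k + 1 - j) * w ^ j)
      = (\<Sum>j\<le>k. - d * real (Suc k) * (fact k / fact j * (- d) ^ (k + 1 - j) * w ^ j))"
    by (intro sum.cong) (auto simp: Suc_diff_le)
  then have "(\<Sum>j\<le>k. fact (Suc k) / fact j * (- d) ^ (Suc k + 1 - j) * w ^ j)
      = - d * real (Suc k) * tail_poly d k w"
    by (simp only: tail_poly_def sum_distrib_left)
  moreover have "tail_poly d (Suc k) w
      = (\<Sum>j\<le>k. fact (Suc k) / fact j * (- d) ^ (Suc k + 1 - j) * w ^ j) + - d * w ^ Suc k"
    unfolding tail_poly_def sum.atMost_Suc by simp
  ultimately show ?thesis
    by (simp only: distrib_left mult.assoc)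
qed

lemma DERIV_exp_tail_poly:
  assumes "d \<noteq> 0"
  shows "((\<lambda>w. - exp (w / d) * tail_poly d k w) has_real_derivative w ^ k * exp (w / d)) (at w)"
proof (induction k)
  case 0
  show ?case
    using assms by (auto simp: tail_poly_def intro!: derivative_eq_intros)
next
  case (Suc k)
  have "((\<lambda>w. d * exp (w / d) * w ^ Suc k) has_real_derivative
      exp (w / d) * w ^ Suc k + d * exp (w / d) * (real (Suc k) * w ^ k)) (at w)"
    using assms by (auto intro!: derivative_eq_intros simp del: power_Suc)
  from DERIV_add [OF DERIV_cmult [OF Suc.IH, of "- d * real (Suc k)"] this]
  have "((\<lambda>w. - d * real (Suc k) * (- exp (w / d) * tail_poly d k w) + d * exp (w / d) * w ^ Suc k)
      has_real_derivative w ^ Suc k * exp (w / d)) (at w)"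
    by (simp add: algebra_simps)
  then show ?case
    by (simp add: tail_poly_Suc algebra_simps)
qed

lemma tail_poly_0: "tail_poly d k 0 = fact k * (- d) ^ (k + 1)"
  by (induction k) (auto simp: tail_poly_Suc, simp add: tail_poly_def)

text \<open>The substitution \<open>w = c t\<close> in the tail integral; it reduces the rate \<open>2/\<sigma>\<close> to the rate 1 of the
  Gamma function.\<close>

lemma tail_poly_scale:
  assumes "c > 0"
  shows "tail_poly (- c) k w = c ^ (k + 1) * tail_poly (- 1) k (w / c)"
proof (induction k)
  case 0
  show ?case by (simp add: tail_poly_def)
next
  case (Suc k)
  then show ?case using assms
    by (simp add: tail_poly_Suc field_simps)
qed

lemma tail_poly_nonneg:
  assumes "d \<le> 0" "0 \<le> w" shows "0 \<le> tail_poly d k w"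
  using assms by (auto simp: tail_poly_def intro!: sum_nonneg mult_nonneg_nonneg)

text \<open>At a positive integer argument the incomplete Gamma function is elementary, since the tail integral
  has the antiderivative above. This identifies the boundary terms at \<open>h\<close> of the integrals below
  with the Gamma values in the recursion.\<close>

lemma upper_Gamma_Suc:
  assumes "0 < y"
  shows "upper_Gamma (1 + real k) y = exp (- y) * tail_poly (- 1) k y"
proof -
  have lim: "((\<lambda>t. - exp (- t) * tail_poly (- 1) k t) \<longlongrightarrow> 0) at_top"
  proof -
    have "((\<lambda>t::real. \<Sum>j\<le>k. - (fact k / fact j) * (t ^ j / exp t)) \<longlongrightarrow> (\<Sum>j\<le>k. - (fact k / fact j) * 0)) at_top"
      by (intro tendsto_intros tendsto_power_div_exp_0)
    moreover have "(\<Sum>j\<le>k. - (fact k / fact j) * (t ^ j / exp t)) = - exp (- t) * tail_poly (- 1) k t" for t :: real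
      by (simp add: tail_poly_def sum_distrib_left exp_minus field_simps sum_negf)
    ultimately show ?thesis by simp
  qed
  have "(\<integral>\<^sup>+t. ennreal (t ^ k * exp (- t)) * indicator {y..} t \<partial>lborel)
      = ennreal (0 - (- exp (- y) * tail_poly (- 1) k y))"
    using assms DERIV_exp_tail_poly [of "- 1" k]
    by (intro nn_integral_FTC_atLeast lim) auto
  then have nn: "(\<integral>\<^sup>+t. ennreal (indicator {y..} t * (t ^ k * exp (- t))) \<partial>lborel)
      = ennreal (exp (- y) * tail_poly (- 1) k y)"
    by (simp add: indicator_mult_ennreal mult.commute)
  have "upper_Gamma (1 + real k) y = (\<integral>t. indicator {y..} t * (t ^ k * exp (- t)) \<partial>lborel)"
    unfolding upper_Gamma_def set_lebesgue_integral_def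
    using assms by (intro Bochner_Integration.integral_cong)
      (auto simp: powr_realpow indicator_def)
  also have "\<dots> = exp (- y) * tail_poly (- 1) k y"
    using assms nn
    by (subst integral_eq_nn_integral) (auto simp: indicator_def tail_poly_nonneg)
  finally show ?thesis .
qed

section \<open>The coefficient recursion as an identity of polynomials\<close>

text \<open>Interchanging a triangular double sum. The power \<open>x\<^sup>k\<^sup>+\<^sup>1 / (k + 1)\<close> is the term \<open>j = k + 1\<close> that
  continues the pattern of \<open>tail_poly d k x\<close>, so it supplies the lowest index \<open>k = j - 1\<close>
  of the inner sum; the constant term is kept apart because the recursion treats \<open>j = 0\<close>
  separately.\<close>

lemma sum_coeffs_tail_poly:
  fixes a :: "nat \<Rightarrow> real"
  shows "(\<Sum>k<N. a k * (tail_poly d k x + x ^ (k + 1) / real (k + 1)))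
    = (\<Sum>k<N. a k * (fact k * (- d) ^ (k + 1)))
      + (\<Sum>j=1..N. (\<Sum>k\<in>{j - 1..<N}. a k * (- d) ^ (k + 1 - j) * (fact k / fact j)) * x ^ j)"
proof -
  let ?t = "\<lambda>k j. a k * (- d) ^ (k + 1 - j) * (fact k / fact j) * x ^ j"
  have row: "a k * (tail_poly d k x + x ^ (k + 1) / real (k + 1))
      = a k * (fact k * (- d) ^ (k + 1)) + (\<Sum>j=1..k + 1. ?t k j)" for k
  proof -
    have "(\<Sum>j=1..k + 1. ?t k j) + ?t k 0 = (\<Sum>j\<le>k + 1. ?t k j)"
      by (simp only: atMost_atLeast0 sum.atLeast_Suc_atMost [of 0 "k + 1"]) simp
    also have "\<dots> = (\<Sum>j\<le>k. ?t k j) + a k * x ^ (k + 1) * (fact k / fact (k + 1))"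
      by (simp del: fact_Suc)
    also have "fact k / fact (k + 1) = 1 / real (k + 1)"
      unfolding Suc_eq_plus1 [symmetric] fact_Suc by simp
    also have "(\<Sum>j\<le>k. ?t k j) = a k * tail_poly d k x"
      unfolding tail_poly_def sum_distrib_left by (intro sum.cong) auto
    also have "a k * tail_poly d k x + a k * x ^ (k + 1) * (1 / real (k + 1))
        = a k * (tail_poly d k x + x ^ (k + 1) / real (k + 1))"
      by (simp only: distrib_left times_divide_eq_right mult_1_right)
    finally show ?thesis by (simp add: mult_ac)
  qed
  have "(\<Sum>k<N. \<Sum>j=1..k + 1. ?t k j) = (\<Sum>j=1..N. \<Sum>k\<in>{j - 1..<N}. ?t k j)"
    unfolding sum.Sigma [OF finite_lessThan ballI [OF finite_atLeastAtMost]]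
      sum.Sigma [OF finite_atLeastAtMost ballI [OF finite_atLeastLessThan]]
    by (rule sum.reindex_bij_witness [where i = "\<lambda>(j, k). (k, j)" and j = "\<lambda>(k, j). (j, k)"]) auto
  then show ?thesis
    unfolding row sum.distrib by (simp add: sum_distrib_right)
qed

text \<open>The bracket of the exit time formula, without the prefactor \<open>1 / (2\<^sup>n \<sigma>\<^sup>n\<^sup>-\<^sup>1)\<close>. With this
  normalisation the renewal equation becomes
  \<open>S\<^sub>n\<^sub>+\<^sub>1(x) = \<integral>\<^sub>0\<^sup>h exp (- \<bar>w - x\<bar> / \<sigma>) S\<^sub>n(w) dw + \<sigma> exp (- x / \<sigma>) S\<^sub>n(0)\<close>, free of powers of 2.\<close>

definition closed_form :: "real \<Rightarrow> real \<Rightarrow> nat \<Rightarrow> real \<Rightarrow> real" where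
  "closed_form \<sigma> h n x =
    (\<Sum>j<n. alpha \<sigma> h n j * x ^ j) * exp (x / \<sigma>) + (\<Sum>j<n - 1. beta \<sigma> h n j * x ^ j) * exp (- x / \<sigma>)"

text \<open>For \<open>n = 1\<close> the sum over \<open>beta\<close> is empty, and the identity still holds because the initial
  condition sets \<open>beta \<sigma> h 1 0\<close> to 0.\<close>

lemma closed_form_0:
  assumes "0 < n" shows "closed_form \<sigma> h n 0 = alpha \<sigma> h n 0 + beta \<sigma> h n 0"
proof -
  have *: "(\<Sum>j<N. a j * 0 ^ j) = (if N = 0 then 0 else a 0)" for N and a :: "nat \<Rightarrow> real"
    by (induction N) auto
  obtain m where "n = Suc m" using assms by (cases n) auto
  then show ?thesis
    by (cases m) (auto simp: closed_form_def * simp del: alpha.simps beta.simps, simp)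
qed

text \<open>The right-hand side is the factor of \<open>exp (x / \<sigma>)\<close> in the kernel integral: the first two sums are the
  antiderivative on \<open>[x, h]\<close> at \<open>h\<close>, and the last one collects the lower limit \<open>x\<close> of that integral and
  the upper limit \<open>x\<close> of the integral over \<open>[0, x]\<close>.\<close>

lemma alpha_poly_Suc:
  assumes "0 < n"
  shows "(\<Sum>j<Suc n. alpha \<sigma> h (Suc n) j * x ^ j)
    = (\<Sum>k<n. alpha \<sigma> h n k * (h ^ (k + 1) / real (k + 1)))
      - (\<Sum>k<n - 1. beta \<sigma> h n k * ((\<sigma> / 2) ^ (k + 1) * upper_Gamma (1 + real k) (2 * h / \<sigma>)))
      - (\<Sum>k<n. alpha \<sigma> h n k * (tail_poly (\<sigma> / 2) k x + x ^ (k + 1) / real (k + 1)))"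
proof -
  have split: "(\<Sum>j<Suc n. alpha \<sigma> h (Suc n) j * x ^ j)
      = alpha \<sigma> h (Suc n) 0 + (\<Sum>j=1..n. alpha \<sigma> h (Suc n) j * x ^ j)"
    by (simp only: lessThan_Suc_atMost atMost_atLeast0 sum.atLeast_Suc_atMost [of 0 n]) simp
  have tl: "(\<Sum>j=1..n. alpha \<sigma> h (Suc n) j * x ^ j)
     = - (\<Sum>j=1..n. (\<Sum>k\<in>{j - 1..<n}. alpha \<sigma> h n k * (- (\<sigma> / 2)) ^ (k + 1 - j) * (fact k / fact j)) * x ^ j)"
    unfolding sum_negf [symmetric]
    by (intro sum.cong refl) auto
  have hd: "alpha \<sigma> h (Suc n) 0 
    = (\<Sum>k<n. alpha \<sigma> h n k * (h ^ (k + 1) / real (k + 1)))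
      - (\<Sum>k<n. alpha \<sigma> h n k * (fact k * (- (\<sigma> / 2)) ^ (k + 1)))
      - (\<Sum>k<n - 1. beta \<sigma> h n k * ((\<sigma> / 2) ^ (k + 1) * upper_Gamma (1 + real k) (2 * h / \<sigma>)))"
    using assms
    by (simp add: atLeast0LessThan sum_subtractf [symmetric] power_minus[of "\<sigma>/2"] power_divide algebra_simps
         flip: sum.distrib)
  show ?thesis
    unfolding split tl hd sum_coeffs_tail_poly by simp
qed

text \<open>Likewise the factor of \<open>exp (- x / \<sigma>)\<close>: the first sum is the boundary term at 0, the second one collects
  the boundary terms at \<open>x\<close>, and the last term is the mass reflected to 0.\<close>

lemma beta_poly_Suc:
  assumes "0 < n"
  shows "(\<Sum>j<n. beta \<sigma> h (Suc n) j * x ^ j)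
    = (\<Sum>k<n. alpha \<sigma> h n k * (fact k * (- (\<sigma> / 2)) ^ (k + 1)))
      + (\<Sum>k<n - 1. beta \<sigma> h n k * (tail_poly (- (\<sigma> / 2)) k x + x ^ (k + 1) / real (k + 1)))
      + \<sigma> * closed_form \<sigma> h n 0"
proof -
  obtain m where m: "n = Suc m" using assms by (cases n) auto
  have split: "(\<Sum>j<n. beta \<sigma> h (Suc n) j * x ^ j)
      = beta \<sigma> h (Suc n) 0 + (\<Sum>j=1..n - 1. beta \<sigma> h (Suc n) j * x ^ j)"
    unfolding m
    by (simp only: lessThan_Suc_atMost atMost_atLeast0 sum.atLeast_Suc_atMost [of 0 m]) simp
  have tl: "(\<Sum>j=1..n - 1. beta \<sigma> h (Suc n) j * x ^ j)
     = (\<Sum>j=1..n - 1. (\<Sum>k\<in>{j - 1..<n - 1}. beta \<sigma> h n k * (- (- (\<sigma> / 2))) ^ (k + 1 - j) * (fact k / fact j)) * x ^ j)"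
    by (intro sum.cong refl) auto
  have hd: "beta \<sigma> h (Suc n) 0 
    = (\<Sum>k<n. alpha \<sigma> h n k * (fact k * (- (\<sigma> / 2)) ^ (k + 1)))
      + (\<Sum>k<n - 1. beta \<sigma> h n k * (fact k * (- (- (\<sigma> / 2))) ^ (k + 1)))
      + \<sigma> * closed_form \<sigma> h n 0"
    using assms
    by (simp add: closed_form_0 atLeast0LessThan power_minus[of "\<sigma>/2"] power_divide algebra_simps sum_negf)
  show ?thesis
    unfolding split tl hd sum_coeffs_tail_poly by simp
qed

section \<open>The integral operator on the closed form\<close>

text \<open>The kernel is split at \<open>w = x\<close>, where \<open>exp (- \<bar>w - x\<bar> / \<sigma>)\<close> is \<open>exp (- x / \<sigma>) exp (w / \<sigma>)\<close> on the left and
  \<open>exp (x / \<sigma>) exp (- w / \<sigma>)\<close> on the right. Both halves have explicit antiderivatives, \<open>F\<close> and \<open>G\<close>, and the four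
  boundary values are matched with the recursion for the coefficients.\<close>

lemma has_integral_kernel_closed_form:
  assumes "0 < \<sigma>" "0 < n" "0 \<le> x" "x \<le> h" "0 < h"
  shows "((\<lambda>w. exp (- \<bar>w - x\<bar> / \<sigma>) * closed_form \<sigma> h n w) has_integral
    closed_form \<sigma> h (Suc n) x - \<sigma> * exp (- x / \<sigma>) * closed_form \<sigma> h n 0) {0..h}"
proof -
  let ?a = "alpha \<sigma> h n" and ?b = "beta \<sigma> h n"
  define F where "F w = (\<Sum>k<n. ?a k * (- exp (w / (\<sigma> / 2)) * tail_poly (\<sigma> / 2) k w))
    + (\<Sum>k<n - 1. ?b k * (w ^ (k + 1) / real (k + 1)))" for w
  define G where "G w = (\<Sum>k<n. ?a k * (w ^ (k + 1) / real (k + 1)))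
    + (\<Sum>k<n - 1. ?b k * (- exp (w / (- (\<sigma> / 2))) * tail_poly (- (\<sigma> / 2)) k w))" for w
  have pw: "((\<lambda>w. w ^ (k + 1) / real (k + 1)) has_real_derivative w ^ k) (at w)" for k w
    using DERIV_cdivide [OF DERIV_pow [of "k + 1" w], of "real (k + 1)"] by simp
  have expF: "exp (w / (\<sigma> / 2)) = exp (w / \<sigma>) * exp (w / \<sigma>)"
    and expG: "exp (w / (- (\<sigma> / 2))) = exp (- w / \<sigma>) * exp (- w / \<sigma>)"
    and exp1: "exp (w / \<sigma>) * exp (- w / \<sigma>) = 1" for w
    by (simp_all flip: exp_add)
  have F': "(F has_real_derivative exp (w / \<sigma>) * closed_form \<sigma> h n w) (at w)" for w
  proof -
    have "(F has_real_derivative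
        (\<Sum>k<n. ?a k * (w ^ k * exp (w / (\<sigma> / 2)))) + (\<Sum>k<n - 1. ?b k * w ^ k)) (at w)"
      unfolding F_def using assms
      by (intro DERIV_add DERIV_sum DERIV_cmult DERIV_exp_tail_poly pw) auto
    also have "(\<Sum>k<n. ?a k * (w ^ k * exp (w / (\<sigma> / 2)))) + (\<Sum>k<n - 1. ?b k * w ^ k)
        = exp (w / \<sigma>) * (exp (w / \<sigma>) * (\<Sum>k<n. ?a k * w ^ k))
          + (exp (w / \<sigma>) * exp (- w / \<sigma>)) * (\<Sum>k<n - 1. ?b k * w ^ k)"
      unfolding expF exp1 by (simp add: sum_distrib_left sum_distrib_right mult_ac)
    also have "\<dots> = exp (w / \<sigma>) * closed_form \<sigma> h n w"
      by (simp only: closed_form_def algebra_simps)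
    finally show ?thesis .
  qed
  have G': "(G has_real_derivative exp (- w / \<sigma>) * closed_form \<sigma> h n w) (at w)" for w
  proof -
    have "(G has_real_derivative
        (\<Sum>k<n. ?a k * w ^ k) + (\<Sum>k<n - 1. ?b k * (w ^ k * exp (w / (- (\<sigma> / 2)))))) (at w)"
      unfolding G_def using assms
      by (intro DERIV_add DERIV_sum DERIV_cmult DERIV_exp_tail_poly pw) auto
    also have "(\<Sum>k<n. ?a k * w ^ k) + (\<Sum>k<n - 1. ?b k * (w ^ k * exp (w / (- (\<sigma> / 2)))))
        = (exp (w / \<sigma>) * exp (- w / \<sigma>)) * (\<Sum>k<n. ?a k * w ^ k)
          + exp (- w / \<sigma>) * (exp (- w / \<sigma>) * (\<Sum>k<n - 1. ?b k * w ^ k))"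
      unfolding expG exp1 by (simp add: sum_distrib_left sum_distrib_right mult_ac)
    also have "\<dots> = exp (- w / \<sigma>) * closed_form \<sigma> h n w"
      by (simp only: closed_form_def algebra_simps)
    finally show ?thesis .
  qed
  have left: "((\<lambda>w. exp (- \<bar>w - x\<bar> / \<sigma>) * closed_form \<sigma> h n w) has_integral
      exp (- x / \<sigma>) * F x - exp (- x / \<sigma>) * F 0) {0..x}"
  proof (rule has_integral_eq [OF _ fundamental_theorem_of_calculus])
    fix w
    show "((\<lambda>w. exp (- x / \<sigma>) * F w) has_vector_derivative
        exp (- x / \<sigma>) * (exp (w / \<sigma>) * closed_form \<sigma> h n w)) (at w within {0..x})"
      using DERIV_cmult [OF F', of "exp (- x / \<sigma>)" w]
      unfolding has_real_derivative_iff_has_vector_derivative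
      by (rule has_vector_derivative_at_within)
  next
    fix w assume "w \<in> {0..x}"
    then have "exp (- \<bar>w - x\<bar> / \<sigma>) = exp (- x / \<sigma>) * exp (w / \<sigma>)"
      by (simp add: diff_divide_distrib flip: exp_add)
    then show "exp (- x / \<sigma>) * (exp (w / \<sigma>) * closed_form \<sigma> h n w)
        = exp (- \<bar>w - x\<bar> / \<sigma>) * closed_form \<sigma> h n w" by simp
  qed (use assms in auto)
  have right: "((\<lambda>w. exp (- \<bar>w - x\<bar> / \<sigma>) * closed_form \<sigma> h n w) has_integral
      exp (x / \<sigma>) * G h - exp (x / \<sigma>) * G x) {x..h}"
  proof (rule has_integral_eq [OF _ fundamental_theorem_of_calculus])
    fix w
    show "((\<lambda>w. exp (x / \<sigma>) * G w) has_vector_derivative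
        exp (x / \<sigma>) * (exp (- w / \<sigma>) * closed_form \<sigma> h n w)) (at w within {x..h})"
      using DERIV_cmult [OF G', of "exp (x / \<sigma>)" w]
      unfolding has_real_derivative_iff_has_vector_derivative
      by (rule has_vector_derivative_at_within)
  next
    fix w assume "w \<in> {x..h}"
    then have "exp (- \<bar>w - x\<bar> / \<sigma>) = exp (x / \<sigma>) * exp (- w / \<sigma>)"
      by (simp add: diff_divide_distrib flip: exp_add)
    then show "exp (x / \<sigma>) * (exp (- w / \<sigma>) * closed_form \<sigma> h n w)
        = exp (- \<bar>w - x\<bar> / \<sigma>) * closed_form \<sigma> h n w" by simp
  qed (use assms in auto)
  have F0: "F 0 = - (\<Sum>k<n. ?a k * (fact k * (- (\<sigma> / 2)) ^ (k + 1)))"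
    by (simp add: F_def tail_poly_0 sum_negf)
  have gam: "exp (h / (- (\<sigma> / 2))) * tail_poly (- (\<sigma> / 2)) k h
      = (\<sigma> / 2) ^ (k + 1) * upper_Gamma (1 + real k) (2 * h / \<sigma>)" for k
    using assms by (simp add: upper_Gamma_Suc tail_poly_scale [of "\<sigma> / 2"] mult.commute)
  have Gh: "G h = (\<Sum>k<n. ?a k * (h ^ (k + 1) / real (k + 1)))
      - (\<Sum>k<n - 1. ?b k * ((\<sigma> / 2) ^ (k + 1) * upper_Gamma (1 + real k) (2 * h / \<sigma>)))"
    unfolding G_def mult_minus_left gam by (simp only: mult_minus_right sum_negf diff_conv_add_uminus)
  have step: "closed_form \<sigma> h (Suc n) x
      = (exp (- x / \<sigma>) * F x - exp (- x / \<sigma>) * F 0) + (exp (x / \<sigma>) * G h - exp (x / \<sigma>) * G x)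
        + \<sigma> * exp (- x / \<sigma>) * closed_form \<sigma> h n 0"
  proof -
    let ?E = "exp (x / \<sigma>)" and ?E' = "exp (- x / \<sigma>)"
    let ?at = "\<Sum>k<n. ?a k * tail_poly (\<sigma> / 2) k x" and ?ap = "\<Sum>k<n. ?a k * (x ^ (k + 1) / real (k + 1))"
    let ?bt = "\<Sum>k<n - 1. ?b k * tail_poly (- (\<sigma> / 2)) k x" and ?bp = "\<Sum>k<n - 1. ?b k * (x ^ (k + 1) / real (k + 1))"
    have "?E' * F x = - (?E * ?E') * ?E * ?at + ?E' * ?bp"
      unfolding F_def expF by (simp add: sum_distrib_left sum_negf distrib_left right_diff_distrib mult_ac)
    then have Fx: "?E' * F x = - ?E * ?at + ?E' * ?bp"
      unfolding exp1 by simp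
    have "?E * G x = ?E * ?ap - (?E * ?E') * ?E' * ?bt"
      unfolding G_def expG by (simp add: sum_distrib_left sum_negf distrib_left right_diff_distrib mult_ac)
    then have Gx: "?E * G x = ?E * ?ap - ?E' * ?bt"
      unfolding exp1 by simp
    have "closed_form \<sigma> h (Suc n) x = (G h - (?at + ?ap)) * ?E
        + (- F 0 + (?bt + ?bp) + \<sigma> * closed_form \<sigma> h n 0) * ?E'"
      unfolding closed_form_def [of \<sigma> h "Suc n"] alpha_poly_Suc [OF \<open>0 < n\<close>] diff_Suc_1
        beta_poly_Suc [OF \<open>0 < n\<close>] F0 Gh distrib_left sum.distrib by simp
    then show ?thesis
      unfolding Fx Gx by (simp add: algebra_simps)
  qed
  show ?thesis
    using has_integral_combine [OF assms(3,4) left right] unfolding step by simp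
qed

section \<open>The first step of the Lindley process\<close>

lemma lindley_cong:
  assumes "\<And>i. 1 \<le> i \<Longrightarrow> z i = z' i"
  shows "lindley x z n = lindley x z' n"
  using assms by (induction n) auto

lemma exit_time_cong:
  assumes "\<And>i. 1 \<le> i \<Longrightarrow> z i = z' i"
  shows "exit_time h x z = exit_time h x z'"
  by (simp add: exit_time_def lindley_cong [OF assms])

lemma lindley_first_step:
  "lindley x z (Suc n) = lindley (max 0 (x + z 1)) (\<lambda>i. z (Suc i)) n"
  by (induction n) auto

text \<open>This form of the exit event involves finitely many steps of the process, which makes it visibly
  measurable and lets the first step be split off.\<close>

lemma exit_time_eq_iff:
  assumes "0 < n"
  shows "exit_time h x z = enat n \<longleftrightarrow> (\<forall>m\<in>{0<..<n}. lindley x z m < h) \<and> h \<le> lindley x z n"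
proof -
  let ?S = "{n. 0 < n \<and> h \<le> lindley x z n}"
  have "exit_time h x z = enat n \<longleftrightarrow> n \<in> ?S \<and> (\<forall>m\<in>?S. n \<le> m)"
  proof
    assume eq: "exit_time h x z = enat n"
    then have "?S \<noteq> {}"
      by (intro notI) (simp only: exit_time_def image_empty Inf_enat_def simp_thms if_True enat.distinct)
    then obtain k where "enat k \<in> enat ` ?S" by blast
    then have "(LEAST e. e \<in> enat ` ?S) \<in> enat ` ?S" by (rule LeastI)
    with \<open>?S \<noteq> {}\<close> have "Inf (enat ` ?S) \<in> enat ` ?S"
      by (simp only: Inf_enat_def image_is_empty if_False)
    then have "n \<in> ?S" using eq by (auto simp: exit_time_def)
    moreover have "n \<le> m" if "m \<in> ?S" for m
      using Inf_lower [of "enat m" "enat ` ?S"] that eq by (auto simp: exit_time_def)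
    ultimately show "n \<in> ?S \<and> (\<forall>m\<in>?S. n \<le> m)" by blast
  next
    assume "n \<in> ?S \<and> (\<forall>m\<in>?S. n \<le> m)"
    then show "exit_time h x z = enat n"
      unfolding exit_time_def by (intro antisym Inf_lower Inf_greatest) auto
  qed
  also have "\<dots> \<longleftrightarrow> (\<forall>m\<in>{0<..<n}. lindley x z m < h) \<and> h \<le> lindley x z n"
    using assms by (simp add: Ball_def) (meson linorder_not_le)
  finally show ?thesis .
qed

lemma exit_time_first_step:
  assumes "0 < n" "0 < h"
  shows "exit_time h x z = enat (Suc n) \<longleftrightarrow>
    x + z 1 < h \<and> exit_time h (max 0 (x + z 1)) (\<lambda>i. z (Suc i)) = enat n"
proof -
  have "(\<forall>m\<in>{0<..<Suc n}. lindley x z m < h) \<longleftrightarrow>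
      (\<forall>m<n. lindley (max 0 (x + z 1)) (\<lambda>i. z (Suc i)) m < h)"
    unfolding lindley_first_step [symmetric]
    by (metis (no_types, lifting) Suc_less_eq Suc_pred' greaterThanLessThan_iff zero_less_Suc)
  also have "\<dots> \<longleftrightarrow> x + z 1 < h \<and>
      (\<forall>m\<in>{0<..<n}. lindley (max 0 (x + z 1)) (\<lambda>i. z (Suc i)) m < h)"
  proof -
    have "lindley (max 0 (x + z 1)) (\<lambda>i. z (Suc i)) 0 < h \<longleftrightarrow> x + z 1 < h"
      using assms by simp
    then show ?thesis
      using assms by (metis greaterThanLessThan_iff neq0_conv)
  qed
  finally show ?thesis
    using assms by (simp only: exit_time_eq_iff zero_less_Suc lindley_first_step conj_assoc)
qed

lemma exit_time_eq_1_iff: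
  assumes "0 < h" shows "exit_time h x z = enat 1 \<longleftrightarrow> h - x \<le> z 1"
  using assms by (auto simp: exit_time_eq_iff)

text \<open>The induction on the exit time passes from \<open>Z\<close> to the increments after the first step, so the
  independence hypothesis has to be inherited by the shifted sequence.\<close>

lemma (in prob_space) indep_vars_shift:
  assumes "indep_vars (\<lambda>_. N) Z {1::nat..}"
  shows "indep_vars (\<lambda>_. N) (\<lambda>i. Z (Suc i)) {1..}"
  unfolding indep_vars_def2 indep_sets_def
proof (intro conjI ballI allI impI)
  let ?F = "\<lambda>i. {Z i -` A \<inter> space M |A. A \<in> sets N}"
  have rv: "\<And>i. 1 \<le> i \<Longrightarrow> random_variable N (Z i)" and ind: "indep_sets ?F {1..}"
    using assms by (auto simp: indep_vars_def2)
  show "random_variable N (Z (Suc i))" if "i \<in> {1..}" for i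
    using rv that by simp
  show "{Z (Suc i) -` A \<inter> space M |A. A \<in> sets N} \<subseteq> events" if "i \<in> {1..}" for i
    using rv [of "Suc i"] that by (auto simp: measurable_sets)
  fix J A assume J: "J \<subseteq> {1::nat..}" "J \<noteq> {}" "finite J"
    and A: "A \<in> (\<Pi> i\<in>J. {Z (Suc i) -` A \<inter> space M |A. A \<in> sets N})"
  have "prob (\<Inter>j\<in>Suc ` J. A (j - 1)) = (\<Prod>j\<in>Suc ` J. prob (A (j - 1)))"
    by (rule indep_setsD [OF ind]) (use J A in auto)
  then show "prob (\<Inter>j\<in>J. A j) = (\<Prod>j\<in>J. prob (A j))"
    by (simp add: prod.reindex image_image)
qed

text \<open>The exit event depends on the pair consisting of the first increment and the sequence \<open>V\<close> of all
  later ones. By independence its law is a product measure, and Fubini integrates the probability of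
  the section at \<open>Z\<^sub>1 = z\<close>, which is an exit event of the shifted process, against the law of \<open>Z\<^sub>1\<close>.\<close>

lemma (in prob_space) exit_prob_first_step:
  assumes ind: "indep_vars (\<lambda>_. borel) Z {1..}"
    and f: "distributed M lborel (Z 1) f"
    and n: "0 < n" and h: "0 < h"
  shows "ennreal (exit_prob M Z h (Suc n) x)
    = (\<integral>\<^sup>+z. f z * (indicator {..<h - x} z * ennreal (exit_prob M (\<lambda>i. Z (Suc i)) h n (max 0 (x + z)))) \<partial>lborel)"
proof -
  \<comment> \<open>Independence of two variables requires a common value type, so the first increment is kept as
    a function on a singleton index set.\<close>
  let ?P1 = "PiM {1::nat} (\<lambda>_. borel :: real measure)" and ?P = "PiM {2::nat..} (\<lambda>_. borel :: real measure)"
  define U where "U \<omega> = restrict (\<lambda>i. Z i \<omega>) {1}" for \<omega>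
  define V where "V \<omega> = restrict (\<lambda>i. Z i \<omega>) {2..}" for \<omega>
  have "indep_var ?P1 U ?P V"
    unfolding U_def V_def by (rule indep_var_restrict [OF ind]) auto
  then have U [measurable]: "random_variable ?P1 U" and V [measurable]: "random_variable ?P V"
    and joint: "distr M ?P1 U \<Otimes>\<^sub>M distr M ?P V = distr M (?P1 \<Otimes>\<^sub>M ?P) (\<lambda>\<omega>. (U \<omega>, V \<omega>))"
    by (auto simp: indep_var_distribution_eq)
  interpret V: prob_space "distr M ?P V" by (rule prob_space_distr) fact
  let ?E = "\<lambda>z v. exit_time h (max 0 (x + z)) (\<lambda>i. v (Suc i)) = enat n"
  define A where "A = {p \<in> space (borel \<Otimes>\<^sub>M ?P). fst p < h - x \<and> ?E (fst p) (snd p)}"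
  have [measurable]: "(\<lambda>p. lindley (max 0 (x + fst p)) (\<lambda>i. snd p (Suc i)) m) \<in> borel_measurable (borel \<Otimes>\<^sub>M ?P)" for m
  proof (induction m)
    case (Suc m)
    note [measurable] = Suc.IH
    have [measurable]: "(\<lambda>p. snd p (Suc (Suc m))) \<in> borel_measurable (borel \<Otimes>\<^sub>M ?P)"
      by (intro measurable_compose [OF measurable_snd measurable_component_singleton]) auto
    show ?case by simp
  qed simp
  have A [measurable]: "A \<in> sets (borel \<Otimes>\<^sub>M ?P)"
    unfolding A_def exit_time_eq_iff [OF n] by measurable
  have restr: "exit_time h y (\<lambda>i. V \<omega> (Suc i)) = exit_time h y (\<lambda>i. Z (Suc i) \<omega>)" for y \<omega>
    by (rule exit_time_cong) (simp add: V_def)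
  have V_space: "V \<omega> \<in> space ?P" if "\<omega> \<in> space M" for \<omega>
    using measurable_space [OF V that] .
  define B where "B = (\<lambda>p. (fst p 1, snd p)) -` A \<inter> space (?P1 \<Otimes>\<^sub>M ?P)"
  have B [measurable]: "B \<in> sets (?P1 \<Otimes>\<^sub>M ?P)"
    unfolding B_def by measurable
  have U_space: "U \<omega> \<in> space ?P1" if "\<omega> \<in> space M" for \<omega>
    using measurable_space [OF U that] .
  have [measurable]: "(\<lambda>z. emeasure (distr M ?P V) (Pair z -` A)) \<in> borel_measurable borel"
    using V.measurable_emeasure_Pair [of A borel] by simp
  have "ennreal (exit_prob M Z h (Suc n) x) = emeasure M ((\<lambda>\<omega>. (U \<omega>, V \<omega>)) -` B \<inter> space M)"
    unfolding exit_prob_def emeasure_eq_measure exit_time_first_step [OF n h]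
    by (intro arg_cong [where f = "\<lambda>B. ennreal (measure M B)"])
      (use U_space V_space in \<open>auto simp: A_def B_def U_def restr space_pair_measure\<close>)
  also have "\<dots> = emeasure (distr M ?P1 U \<Otimes>\<^sub>M distr M ?P V) B"
    unfolding joint by (intro emeasure_distr [symmetric] measurable_Pair U V B)
  also have "\<dots> = (\<integral>\<^sup>+u. emeasure (distr M ?P V) (Pair u -` B) \<partial>distr M ?P1 U)"
    by (rule V.emeasure_pair_measure_alt) (use B in simp)
  also have "\<dots> = (\<integral>\<^sup>+u. emeasure (distr M ?P V) (Pair (u 1) -` A) \<partial>distr M ?P1 U)"
  proof (rule nn_integral_cong)
    fix u assume "u \<in> space (distr M ?P1 U)"
    then have "u \<in> space ?P1" by (simp only: space_distr)
    moreover have "v \<in> space ?P" if "(z, v) \<in> A" for z v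
      using that by (simp only: A_def mem_Collect_eq space_pair_measure mem_Times_iff snd_conv)
    ultimately have "v \<in> Pair u -` B \<longleftrightarrow> v \<in> Pair (u 1) -` A" for v
      by (simp only: B_def vimage_eq Int_iff fst_conv snd_conv space_pair_measure mem_Times_iff) blast
    then have "Pair u -` B = Pair (u 1) -` A" by blast
    then show "emeasure (distr M ?P V) (Pair u -` B) = emeasure (distr M ?P V) (Pair (u 1) -` A)"
      by simp
  qed
  also have "\<dots> = (\<integral>\<^sup>+\<omega>. emeasure (distr M ?P V) (Pair (Z 1 \<omega>) -` A) \<partial>M)"
    by (subst nn_integral_distr) (use U in \<open>auto simp: U_def\<close>)
  also have "\<dots> = (\<integral>\<^sup>+z. f z * emeasure (distr M ?P V) (Pair z -` A) \<partial>lborel)"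
    by (rule distributed_nn_integral [OF f, symmetric]) simp
  finally have "ennreal (exit_prob M Z h (Suc n) x)
      = (\<integral>\<^sup>+z. f z * emeasure (distr M ?P V) (Pair z -` A) \<partial>lborel)" .
  moreover have "emeasure (distr M ?P V) (Pair z -` A)
      = indicator {..<h - x} z * ennreal (exit_prob M (\<lambda>i. Z (Suc i)) h n (max 0 (x + z)))" for z
  proof -
    have "emeasure (distr M ?P V) (Pair z -` A) = emeasure M (V -` (Pair z -` A) \<inter> space M)"
      by (rule emeasure_distr [OF V sets_Pair1 [OF A]])
    also have "V -` (Pair z -` A) \<inter> space M
        = (if z < h - x then {\<omega> \<in> space M. exit_time h (max 0 (x + z)) (\<lambda>i. Z (Suc i) \<omega>) = enat n} else {})"
      using V_space by (auto simp: A_def restr space_pair_measure)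
    finally show ?thesis
      by (auto simp: exit_prob_def emeasure_eq_measure)
  qed
  ultimately show ?thesis by simp
qed

section \<open>Laplace increments\<close>

lemma nn_integral_laplace_upper_tail:
  assumes "0 < \<sigma>" "0 \<le> y"
  shows "(\<integral>\<^sup>+z. ennreal (laplace_density 0 \<sigma> z) * indicator {y..} z \<partial>lborel) = ennreal (exp (- y / \<sigma>) / 2)"
proof -
  have lim: "((\<lambda>z. - exp (- z / \<sigma>) / 2) \<longlongrightarrow> 0) at_top"
    using assms by real_asymp
  have "(\<integral>\<^sup>+z. ennreal (laplace_density 0 \<sigma> z) * indicator {y..} z \<partial>lborel)
      = ennreal (0 - (- exp (- y / \<sigma>) / 2))"
    using assms
    by (intro nn_integral_FTC_atLeast lim)
      (auto simp: laplace_density_def intro!: derivative_eq_intros)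
  then show ?thesis by simp
qed

lemma borel_measurable_laplace_density [measurable]: "laplace_density \<mu> \<sigma> \<in> borel_measurable borel"
  unfolding laplace_density_def [abs_def] by measurable

text \<open>This is the probability that a step from \<open>x\<close> is reflected at 0; it follows from the upper tail by
  the symmetry \<open>w \<mapsto> x - w\<close>.\<close>

lemma nn_integral_laplace_lower_tail:
  assumes "0 < \<sigma>" "0 \<le> x"
  shows "(\<integral>\<^sup>+w. ennreal (laplace_density 0 \<sigma> (w - x)) * indicator {..0} w \<partial>lborel) = ennreal (exp (- x / \<sigma>) / 2)"
proof -
  have "(\<integral>\<^sup>+z. ennreal (laplace_density 0 \<sigma> z) * indicator {x..} z \<partial>lborel)
      = ennreal \<bar>- 1\<bar> * (\<integral>\<^sup>+w. ennreal (laplace_density 0 \<sigma> (x + - 1 * w)) * indicator {x..} (x + - 1 * w) \<partial>lborel)"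
    by (rule nn_integral_real_affine) auto
  also have "\<dots> = (\<integral>\<^sup>+w. ennreal (laplace_density 0 \<sigma> (w - x)) * indicator {..0} w \<partial>lborel)"
    by (auto simp: laplace_density_def indicator_def abs_minus_commute intro!: nn_integral_cong)
  finally show ?thesis
    using nn_integral_laplace_upper_tail [OF assms] by simp
qed

text \<open>The renewal equation for the closed form, in the variable \<open>w = x + z\<close>: the part \<open>w \<le> 0\<close> is reflected
  to 0 and contributes the lower tail times the value at 0, and the part \<open>0 < w < h\<close> is the kernel
  integral. Nonnegativity on \<open>[0, h)\<close>, known in the
  application because the closed form is a multiple of a probability, is what makes the integral in
  the extended reals agree with the real one. Nonnegativity at \<open>n + 1\<close> allows the resulting identity
  in the extended reals to be read as one between real numbers.\<close>

lemma nn_integral_laplace_closed_form: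
  assumes "0 < \<sigma>" "0 < h" "0 < n" "0 \<le> x" "x < h"
    and nonneg: "\<And>w. 0 \<le> w \<Longrightarrow> w < h \<Longrightarrow> 0 \<le> closed_form \<sigma> h n w"
  shows "(\<integral>\<^sup>+z. ennreal (laplace_density 0 \<sigma> z) * (indicator {..<h - x} z *
      ennreal (closed_form \<sigma> h n (max 0 (x + z)))) \<partial>lborel) = ennreal (closed_form \<sigma> h (Suc n) x / (2 * \<sigma>))"
    and "0 \<le> closed_form \<sigma> h (Suc n) x"
proof -
  let ?I = "closed_form \<sigma> h (Suc n) x - \<sigma> * exp (- x / \<sigma>) * closed_form \<sigma> h n 0"
  have [measurable]: "closed_form \<sigma> h n \<in> borel_measurable borel"
    unfolding closed_form_def [abs_def] by measurable
  \<comment> \<open>The endpoint \<open>h\<close> is removed since nonnegativity is known only below \<open>h\<close>.\<close>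
  have hi: "((\<lambda>w. laplace_density 0 \<sigma> (w - x) * closed_form \<sigma> h n w) has_integral ?I / (2 * \<sigma>)) {0<..<h}"
    using has_integral_divide [OF has_integral_kernel_closed_form [of \<sigma> n x h, unfolded has_integral_Icc_iff_Ioo], of "2 * \<sigma>"]
      assms by (simp add: laplace_density_def)
  have dens: "0 \<le> laplace_density 0 \<sigma> w" for w
    using assms(1) by (simp add: laplace_density_def)
  have I0: "0 \<le> ?I / (2 * \<sigma>)"
    using hi by (rule has_integral_nonneg) (use assms in \<open>auto simp: laplace_density_def intro!: mult_nonneg_nonneg nonneg\<close>)
  have sum: "closed_form \<sigma> h n 0 * (exp (- x / \<sigma>) / 2) + ?I / (2 * \<sigma>) = closed_form \<sigma> h (Suc n) x / (2 * \<sigma>)"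
    using assms(1) by (simp add: field_simps)
  have "0 \<le> closed_form \<sigma> h (Suc n) x / (2 * \<sigma>)"
    unfolding sum [symmetric] using I0 nonneg [of 0] assms(2) by (intro add_nonneg_nonneg) auto
  then show "0 \<le> closed_form \<sigma> h (Suc n) x"
    using assms(1) by (simp add: zero_le_divide_iff)
  have "(\<integral>\<^sup>+z. ennreal (laplace_density 0 \<sigma> z) * (indicator {..<h - x} z *
      ennreal (closed_form \<sigma> h n (max 0 (x + z)))) \<partial>lborel)
    = (\<integral>\<^sup>+w. ennreal (laplace_density 0 \<sigma> (- x + 1 * w)) * (indicator {..<h - x} (- x + 1 * w) *
      ennreal (closed_form \<sigma> h n (max 0 (x + (- x + 1 * w))))) \<partial>lborel)"
    by (subst nn_integral_real_affine [where t = "- x" and c = 1]) auto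
  also have "\<dots> = (\<integral>\<^sup>+w. ennreal (closed_form \<sigma> h n 0) * (ennreal (laplace_density 0 \<sigma> (w - x)) * indicator {..0} w)
      + ennreal (indicator {0<..<h} w * (laplace_density 0 \<sigma> (w - x) * closed_form \<sigma> h n w)) \<partial>lborel)"
    using assms
    by (intro nn_integral_cong)
      (auto simp: indicator_def max_def ennreal_mult [OF dens nonneg] mult.commute
        [of "ennreal (laplace_density _ _ _)"])
  also have "\<dots> = ennreal (closed_form \<sigma> h n 0) * ennreal (exp (- x / \<sigma>) / 2) + ennreal (?I / (2 * \<sigma>))"
    using nn_integral_has_integral_lebesgue [OF _ hi] assms
    by (subst nn_integral_add)
      (auto simp: nn_integral_cmult nn_integral_laplace_lower_tail dens nonneg)
  also have "\<dots> = ennreal (closed_form \<sigma> h n 0 * (exp (- x / \<sigma>) / 2) + ?I / (2 * \<sigma>))"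
    using I0 nonneg [of 0] assms(2)
    by (subst ennreal_plus) (auto simp: ennreal_mult' simp del: times_divide_eq_right)
  also note sum
  finally show "(\<integral>\<^sup>+z. ennreal (laplace_density 0 \<sigma> z) * (indicator {..<h - x} z *
      ennreal (closed_form \<sigma> h n (max 0 (x + z)))) \<partial>lborel) = ennreal (closed_form \<sigma> h (Suc n) x / (2 * \<sigma>))" .
qed

text \<open>Induction on \<open>n\<close> with the renewal equation. The increments have to vary along with \<open>x\<close>, because the
  induction hypothesis is applied to the shifted sequence.\<close>

lemma (in prob_space) exit_prob_eq_closed_form:
  assumes "indep_vars (\<lambda>_. borel) Z {1..}"
    and "\<And>i. 1 \<le> i \<Longrightarrow> distributed M lborel (Z i) (\<lambda>z. ennreal (laplace_density 0 \<sigma> z))"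
    and "0 < \<sigma>" "0 < h" "0 < n" "0 \<le> x" "x < h"
  shows "exit_prob M Z h n x = closed_form \<sigma> h n x / (2 ^ n * \<sigma> ^ (n - 1))"
  using \<open>0 < n\<close> assms(1,2,6,7)
proof (induction n arbitrary: Z x rule: nat_induct_non_zero)
  case 1
  have "ennreal (exit_prob M Z h 1 x) = emeasure M (Z 1 -` {h - x..} \<inter> space M)"
    unfolding exit_prob_def emeasure_eq_measure exit_time_eq_1_iff [OF \<open>0 < h\<close>]
    by (intro arg_cong [where f = "\<lambda>B. ennreal (measure M B)"]) auto
  also have "\<dots> = ennreal (exp (- (h - x) / \<sigma>) / 2)"
    using distributed_emeasure [OF 1(2) [of 1], of "{h - x..}"] 1 assms
      nn_integral_laplace_upper_tail [of \<sigma> "h - x"] by simp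
  finally have "exit_prob M Z h 1 x = exp (- (h - x) / \<sigma>) / 2"
    by (simp add: exit_prob_def)
  also have "\<dots> = closed_form \<sigma> h 1 x / (2 ^ 1 * \<sigma> ^ (1 - 1))"
    by (simp add: closed_form_def diff_divide_distrib flip: exp_add)
  finally show ?case .
next
  case (Suc n)
  let ?c = "2 ^ n * \<sigma> ^ (n - 1)"
  have c: "0 < ?c" using assms by simp
  have IH: "exit_prob M (\<lambda>i. Z (Suc i)) h n w = closed_form \<sigma> h n w / ?c" if "0 \<le> w" "w < h" for w
    using Suc.prems that by (intro Suc.IH indep_vars_shift) auto
  have nonneg: "0 \<le> closed_form \<sigma> h n w" if "0 \<le> w" "w < h" for w
  proof -
    have "0 \<le> closed_form \<sigma> h n w / ?c"
      unfolding IH [OF that, symmetric] by (simp add: exit_prob_def)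
    then show ?thesis using c by (simp only: zero_le_divide_iff) linarith
  qed
  have "ennreal (exit_prob M Z h (Suc n) x)
      = (\<integral>\<^sup>+z. ennreal (laplace_density 0 \<sigma> z) * (indicator {..<h - x} z *
        ennreal (exit_prob M (\<lambda>i. Z (Suc i)) h n (max 0 (x + z)))) \<partial>lborel)"
    using Suc assms by (intro exit_prob_first_step) auto
  also have "\<dots> = (\<integral>\<^sup>+z. ennreal (1 / ?c) * (ennreal (laplace_density 0 \<sigma> z) * (indicator {..<h - x} z *
        ennreal (closed_form \<sigma> h n (max 0 (x + z))))) \<partial>lborel)"
  proof (intro nn_integral_cong)
    fix z
    show "ennreal (laplace_density 0 \<sigma> z) * (indicator {..<h - x} z *
        ennreal (exit_prob M (\<lambda>i. Z (Suc i)) h n (max 0 (x + z))))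
      = ennreal (1 / ?c) * (ennreal (laplace_density 0 \<sigma> z) * (indicator {..<h - x} z *
        ennreal (closed_form \<sigma> h n (max 0 (x + z)))))"
    proof (cases "z < h - x")
      case True
      then have "exit_prob M (\<lambda>i. Z (Suc i)) h n (max 0 (x + z)) = 1 / ?c * closed_form \<sigma> h n (max 0 (x + z))"
        using IH [of "max 0 (x + z)"] assms(4) by simp
      then have "ennreal (exit_prob M (\<lambda>i. Z (Suc i)) h n (max 0 (x + z)))
          = ennreal (1 / ?c) * ennreal (closed_form \<sigma> h n (max 0 (x + z)))"
        using c by (simp only: ennreal_mult' zero_le_divide_1_iff less_imp_le)
      then show ?thesis
        by (simp only: mult_ac)
    qed simp
  qed
  also have "\<dots> = ennreal (1 / ?c) * ennreal (closed_form \<sigma> h (Suc n) x / (2 * \<sigma>))"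
  proof (subst nn_integral_cmult)
    have [measurable]: "closed_form \<sigma> h n \<in> borel_measurable borel"
      unfolding closed_form_def [abs_def] by measurable
    show "(\<lambda>z. ennreal (laplace_density 0 \<sigma> z) * (indicator {..<h - x} z *
        ennreal (closed_form \<sigma> h n (max 0 (x + z))))) \<in> borel_measurable lborel"
      by measurable
  qed (use nn_integral_laplace_closed_form [OF assms(3,4) Suc.hyps Suc.prems(3,4) nonneg] in simp)
  also have "\<dots> = ennreal (1 / ?c * (closed_form \<sigma> h (Suc n) x / (2 * \<sigma>)))"
    by (rule ennreal_mult' [symmetric]) (use c in simp)
  also have "1 / ?c * (closed_form \<sigma> h (Suc n) x / (2 * \<sigma>)) = closed_form \<sigma> h (Suc n) x / (2 ^ Suc n * \<sigma> ^ n)"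
    using Suc.hyps by (cases n) auto
  finally have "ennreal (exit_prob M Z h (Suc n) x) = ennreal (closed_form \<sigma> h (Suc n) x / (2 ^ Suc n * \<sigma> ^ n))" .
  moreover have "0 \<le> closed_form \<sigma> h (Suc n) x"
    using nn_integral_laplace_closed_form(2) [OF assms(3,4) Suc.hyps Suc.prems(3,4) nonneg] .
  ultimately show ?case
    using assms(3) by (subst (asm) ennreal_inj) (auto simp: exit_prob_def)
qed

theorem theorem4p5:
  fixes M :: "'a measure" and Z :: "nat \<Rightarrow> 'a \<Rightarrow> real"
    and \<sigma> h x :: real and n :: nat
  assumes "prob_space M"
    and "prob_space.indep_vars M (\<lambda>_. borel) Z {1..}"
    and "\<And>i. 1 \<le> i \<Longrightarrow> distributed M lborel (Z i) (\<lambda>z. ennreal (laplace_density 0 \<sigma> z))"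
    and "0 < \<sigma>" and "0 < h"
    and "0 < n" and "0 \<le> x" and "x < h"
  shows "exit_prob M Z h n x =
    1 / (2 ^ n * \<sigma> ^ (n - 1)) *
      ((\<Sum>j\<in>{0..<n}. alpha \<sigma> h n j * x ^ j * exp (x / \<sigma>))
       + (\<Sum>j\<in>{0..<n - 1}. beta \<sigma> h n j * x ^ j * exp (- x / \<sigma>)))"
  using prob_space.exit_prob_eq_closed_form [OF assms]
  by (simp add: closed_form_def atLeast0LessThan sum_distrib_right)

end
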